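(* Let $k\in\mathbb{N}$. There is no automorphism $T$ constructed with the $\mathbb{F}$-method such that \[\lim_{n\to\infty}\frac{\log F_n(T)}{k\log n}=1.\]
   Context: $\mathbb{N}$ denotes the positive integers. For an automorphism $T$ of a compact group $G$ and $n\in\mathbb{N}$, $F_n(T):=\#\{g\in G: T^n g=g\}$. The $\mathbb{F}$-method: consider sequences of pairs of integers $\{(p_n,g_n)\}_{n=1}^{\infty}$ such that (i) each $p_n$ is either prime or equal to $1$, and $p_1=1$; (ii) each $p_n$ satisfies $p_n\equiv 1 \pmod n$; (iii) if $p_n=1$ then $g_n=0$, otherwise $g_n$ is a primitive root modulo $p_n$. To such a sequence the $\mathbb{F}$-method associates the pair $(G,T)$, where $G=\prod_{n=1}^{\infty}\mathbb{F}_{p_n}$ is the direct product (with the product topology) of the additive groups of the finite fields $\mathbb{F}_{p_n}$, each with the discrete topology (with the convention that $\mathbb{F}_{1}$ is the group with one element), and $T(x_1,x_2,\ldots)=(T_1(x_1),T_2(x_2),\ldots)$, where $T_n:\mathbb{F}_{p_n}\to\mathbb{F}_{p_n}$ is the trivial automorphism when $p_n=1$ and is otherwise defined by $T_n(x_n)=g_n^{(p_n-1)/n}x_n$. An automorphism $T$ is said to be constructed with the $\mathbb{F}$-method if $(G,T)$ arises in this way from some such sequence. *)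

theory Defs
  imports
    "HOL-Algebra.Product_Groups"
    "HOL-Number_Theory.Residue_Primitive_Roots"
    "HOL-Number_Theory.Residues"
    "HOL-Analysis.T1_Spaces"
begin

text \<open>Sequences are indexed by the positive integers: the values \<open>p 0\<close> and \<open>g 0\<close> are never used.
  The library predicate for primitive roots is stated for natural numbers, so it is applied to the
  least nonnegative residue of the integer \<open>g n\<close>.\<close>

definition F_sequence :: "(nat \<Rightarrow> nat) \<Rightarrow> (nat \<Rightarrow> int) \<Rightarrow> bool" where
  "F_sequence p g \<longleftrightarrow>
     (\<forall>n\<ge>1. prime (p n) \<or> p n = 1) \<and> p 1 = 1 \<and>
     (\<forall>n\<ge>1. [p n = 1] (mod n)) \<and>
     (\<forall>n\<ge>1. if p n = 1 then g n = 0
            else residue_primroot (p n) (nat (g n mod int (p n))))"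

text \<open>For \<open>p n = 1\<close> the carrier of \<open>residue_ring 1\<close> is \<open>{0}\<close>, so the factor is the
  one-element group.\<close>

definition F_group :: "(nat \<Rightarrow> nat) \<Rightarrow> (nat \<Rightarrow> int) monoid" where
  "F_group p = product_group {1..} (\<lambda>n. add_monoid (residue_ring (int (p n))))"

definition F_topology :: "(nat \<Rightarrow> nat) \<Rightarrow> (nat \<Rightarrow> int) topology" where
  "F_topology p =
     product_topology (\<lambda>n. discrete_topology (carrier (residue_ring (int (p n))))) {1..}"

definition F_map :: "(nat \<Rightarrow> nat) \<Rightarrow> (nat \<Rightarrow> int) \<Rightarrow> (nat \<Rightarrow> int) \<Rightarrow> (nat \<Rightarrow> int)" where
  "F_map p g x =
     (\<lambda>n\<in>{1..}. if p n = 1 then x n else (g n ^ ((p n - 1) div n) * x n) mod int (p n))"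

text \<open>Every \<open>T\<close> constructed in this way is an automorphism of the compact group \<open>G\<close>.\<close>

lemma F_factor_unit:
  assumes "F_sequence p g" "n \<ge> 1"
  shows "p n > 0" "coprime (g n ^ e) (int (p n))"
proof -
  have pn: "prime (p n) \<or> p n = 1" using assms by (auto simp: F_sequence_def)
  show pos: "p n > 0" using pn prime_gt_0_nat by auto
  have "coprime (g n) (int (p n))"
  proof (cases "p n = 1")
    case False
    then have "residue_primroot (p n) (nat (g n mod int (p n)))"
      using assms by (auto simp: F_sequence_def)
    then have "coprime (p n) (nat (g n mod int (p n)))"
      by (simp add: residue_primroot_def)
    then have "coprime (int (p n)) (int (nat (g n mod int (p n))))"
      by (simp only: coprime_int_iff)
    then have "coprime (int (p n)) (g n mod int (p n))" using pos by simp
    then show ?thesis using pos by (simp add: coprime_commute)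
  qed simp
  then show "coprime (g n ^ e) (int (p n))" by simp
qed

lemma F_factor_bij:
  assumes "coprime u m" "(m::int) > 0"
  shows "bij_betw (\<lambda>x. (u * x) mod m) {0..m - 1} {0..m - 1}"
proof -
  have inj: "inj_on (\<lambda>x. (u * x) mod m) {0..m - 1}"
  proof (rule inj_onI)
    fix x y assume xy: "x \<in> {0..m - 1}" "y \<in> {0..m - 1}" "(u * x) mod m = (u * y) mod m"
    then have "[x = y] (mod m)"
      using assms(1) by (simp add: cong_def[symmetric] cong_mult_lcancel)
    then show "x = y" using xy by (simp add: cong_def)
  qed
  have "(\<lambda>x. (u * x) mod m) ` {0..m - 1} \<subseteq> {0..m - 1}"
    using assms(2) by auto
  then show ?thesis using inj by (simp add: bij_betw_def endo_inj_surj)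
qed

lemma F_map_factor:
  assumes "F_sequence p g" "x \<in> carrier (F_group p)"
  shows "F_map p g x = (\<lambda>n\<in>{1..}. (g n ^ ((p n - 1) div n) * x n) mod int (p n))"
proof -
  have "x n = (g n ^ ((p n - 1) div n) * x n) mod int (p n)" if "n \<ge> 1" "p n = 1" for n
  proof -
    have "x n \<in> carrier (residue_ring (int (p n)))"
      using assms(2) that(1) unfolding F_group_def
      by (auto simp del: One_nat_def dest: PiE_mem)
    then show ?thesis using that by (simp add: residue_ring_def)
  qed
  then show ?thesis by (auto simp: F_map_def fun_eq_iff restrict_def)
qed

lemma F_map_bij:
  assumes "F_sequence p g"
  shows "bij_betw (F_map p g) (carrier (F_group p)) (carrier (F_group p))"
proof -
  define f where "f n x = (g n ^ ((p n - 1) div n) * x) mod int (p n)" for n x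
  define C where "C n = {0..int (p n) - 1}" for n
  have C: "carrier (F_group p) = (\<Pi>\<^sub>E n\<in>{1..}. C n)"
    by (simp add: F_group_def residue_ring_def C_def)
  have b: "bij_betw (f n) (C n) (C n)" if "n \<ge> 1" for n
    unfolding f_def C_def
    by (rule F_factor_bij) (use F_factor_unit[OF assms that] in auto)
  have F: "F_map p g x = (\<lambda>n\<in>{1..}. f n (x n))" if "x \<in> (\<Pi>\<^sub>E n\<in>{1..}. C n)" for x
    using F_map_factor[OF assms, of x] that C by (simp add: f_def)
  show ?thesis
    unfolding C
  proof (rule bij_betw_byWitness[where f' = "\<lambda>y. \<lambda>n\<in>{1..}. inv_into (C n) (f n) (y n)"])
    show "\<forall>x\<in>\<Pi>\<^sub>E n\<in>{1..}. C n. (\<lambda>n\<in>{1..}. inv_into (C n) (f n) (F_map p g x n)) = x"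
    proof
      fix x assume x: "x \<in> (\<Pi>\<^sub>E n\<in>{1..}. C n)"
      have "inv_into (C n) (f n) (f n (x n)) = x n" if "n \<ge> 1" for n
        using bij_betw_inv_into_left[OF b[OF that]] x that by auto
      then show "(\<lambda>n\<in>{1..}. inv_into (C n) (f n) (F_map p g x n)) = x"
        using x by (auto simp: F fun_eq_iff PiE_def extensional_def)
    qed
    have iv: "inv_into (C n) (f n) z \<in> C n" if "n \<ge> 1" "z \<in> C n" for n z
      using bij_betwE[OF bij_betw_inv_into[OF b[OF that(1)]]] that by auto
    show sub: "(\<lambda>y. \<lambda>n\<in>{1..}. inv_into (C n) (f n) (y n)) ` (\<Pi>\<^sub>E n\<in>{1..}. C n)
        \<subseteq> (\<Pi>\<^sub>E n\<in>{1..}. C n)"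
      using iv by (auto simp: PiE_iff)
    show "\<forall>y\<in>\<Pi>\<^sub>E n\<in>{1..}. C n. F_map p g (\<lambda>n\<in>{1..}. inv_into (C n) (f n) (y n)) = y"
    proof
      fix y assume y: "y \<in> (\<Pi>\<^sub>E n\<in>{1..}. C n)"
      then have m: "(\<lambda>n\<in>{1..}. inv_into (C n) (f n) (y n)) \<in> (\<Pi>\<^sub>E n\<in>{1..}. C n)"
        using sub by blast
      have "f n (inv_into (C n) (f n) (y n)) = y n" if "n \<ge> 1" for n
        using bij_betw_inv_into_right[OF b[OF that]] y that by auto
      then show "F_map p g (\<lambda>n\<in>{1..}. inv_into (C n) (f n) (y n)) = y"
        unfolding F[OF m] using y by (auto simp: fun_eq_iff PiE_def extensional_def)
    qed
    show "F_map p g ` (\<Pi>\<^sub>E n\<in>{1..}. C n) \<subseteq> (\<Pi>\<^sub>E n\<in>{1..}. C n)"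
      using bij_betwE[OF b] by (auto simp: F PiE_iff)
  qed
qed

lemma F_group_group:
  assumes "F_sequence p g"
  shows "group (F_group p)"
proof -
  have "group (add_monoid (residue_ring (int (p n))))" if n: "n \<ge> 1" for n
  proof -
    have pos: "p n > 0" using F_factor_unit[OF assms n] by simp
    have eq: "add_monoid (residue_ring (int (p n))) = integer_mod_group (p n)"
      using pos
      by (intro monoid.equality)
        (auto simp: residue_ring_def carrier_integer_mod_group)
    show ?thesis unfolding eq by simp
  qed
  then show ?thesis unfolding F_group_def by (intro product_group) simp
qed

lemma F_map_iso:
  assumes "F_sequence p g"
  shows "F_map p g \<in> iso (F_group p) (F_group p)"
proof -
  have "F_map p g \<in> hom (F_group p) (F_group p)"
  proof (rule homI)
    fix x y assume x: "x \<in> carrier (F_group p)" and y: "y \<in> carrier (F_group p)"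
    show "F_map p g x \<in> carrier (F_group p)"
      using F_map_bij[OF assms] x by (auto simp: bij_betw_def)
    have xy: "x \<otimes>\<^bsub>F_group p\<^esub> y \<in> carrier (F_group p)"
      using F_group_group[OF assms] x y by (simp add: group.is_monoid monoid.m_closed)
    show "F_map p g (x \<otimes>\<^bsub>F_group p\<^esub> y) = F_map p g x \<otimes>\<^bsub>F_group p\<^esub> F_map p g y"
      unfolding F_map_factor[OF assms x] F_map_factor[OF assms y] F_map_factor[OF assms xy]
      by (auto simp: F_group_def residue_ring_def fun_eq_iff mod_mult_right_eq mod_add_eq
          distrib_left)
  qed
  then show ?thesis using F_map_bij[OF assms] by (simp add: iso_def)
qed

lemma topspace_F_topology: "topspace (F_topology p) = carrier (F_group p)"
  by (simp add: F_topology_def F_group_def)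

lemma compact_F_topology: "compact_space (F_topology p)"
  by (auto simp: F_topology_def compact_space_product_topology compact_space_discrete_topology
      residue_ring_def)

lemma F_map_homeomorphic:
  assumes "F_sequence p g"
  shows "homeomorphic_map (F_topology p) (F_topology p) (F_map p g)"
proof -
  have "continuous_map (F_topology p) (F_topology p) (F_map p g)"
  proof -
    let ?D = "\<lambda>n. discrete_topology (carrier (residue_ring (int (p n))))"
    have "continuous_map (F_topology p) (?D n) (\<lambda>x. F_map p g x n)" if n: "n \<in> {1..}" for n
    proof -
      let ?h = "\<lambda>z. if p n = 1 then z else (g n ^ ((p n - 1) div n) * z) mod int (p n)"
      have pos: "p n > 0" using F_factor_unit[OF assms] n by simp
      have "continuous_map (F_topology p) (?D n) (\<lambda>x. x n)"
        using n unfolding F_topology_def by (rule continuous_map_product_projection)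
      moreover have "continuous_map (?D n) (?D n) ?h"
        using pos by (auto simp: residue_ring_def)
      ultimately have "continuous_map (F_topology p) (?D n) (?h \<circ> (\<lambda>x. x n))"
        by (rule continuous_map_compose)
      then show ?thesis using n by (simp add: o_def F_map_def)
    qed
    then show ?thesis
      by (subst (2) F_topology_def) (auto simp: continuous_map_componentwise F_map_def)
  qed
  moreover have "Hausdorff_space (F_topology p)"
    by (auto simp: F_topology_def Hausdorff_space_product_topology)
  ultimately show ?thesis
    using F_map_bij[OF assms] compact_F_topology
    by (intro continuous_imp_homeomorphic_map)
      (auto simp: topspace_F_topology bij_betw_def)
qed

definition constructed_with_F_method ::
  "(nat \<Rightarrow> int) monoid \<Rightarrow> (nat \<Rightarrow> int) topology \<Rightarrow> ((nat \<Rightarrow> int) \<Rightarrow> (nat \<Rightarrow> int)) \<Rightarrow> bool" where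
  "constructed_with_F_method G \<tau> T \<longleftrightarrow>
     (\<exists>p g. F_sequence p g \<and> G = F_group p \<and> \<tau> = F_topology p \<and>
            (\<forall>x\<in>carrier G. T x = F_map p g x))"

definition num_fixed :: "('a, 'b) monoid_scheme \<Rightarrow> ('a \<Rightarrow> 'a) \<Rightarrow> nat \<Rightarrow> nat" where
  "num_fixed G T n = card {x \<in> carrier G. (T ^^ n) x = x}"

end

theory Submission
  imports Defs
begin

text \<open>
  On the factor of index \<open>d\<close>, when \<open>p d\<close> is prime, \<open>T\<close> is multiplication by a unit of exact
  multiplicative order \<open>d\<close>, so \<open>T ^^ n\<close> fixes the whole factor when \<open>d\<close> divides \<open>n\<close> and only
  \<open>0\<close> otherwise. Hence \<open>T ^^ n\<close> has \<open>\<Prod>d | d dvd n. p d\<close> fixed points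
  (\<open>num_fixed_eq_prod\<close>).

  For a prime \<open>q\<close>, passing from \<open>n = q ^ k\<close> to \<open>n = q ^ (k + 1)\<close> therefore multiplies the number
  of fixed points by \<open>p (q ^ (k + 1))\<close>, which is either \<open>1\<close> or, being congruent to \<open>1\<close>, larger
  than \<open>q ^ (k + 1)\<close>. If the number of fixed points were \<open>n powr (k + o(1))\<close>, this factor would
  have to be \<open>q powr (k * (k + 1) - k * k + o(1)) = q powr (k + o(1))\<close> as \<open>q\<close> tends to infinity
  through the primes, which lies strictly between the two possibilities because \<open>1 \<le> k\<close>.
\<close>

lemma F_sequence_primeD:
  assumes "F_sequence p g" "d \<ge> 1" "p d \<noteq> 1"
  shows "prime (p d)" "d dvd p d - 1" "residue_primroot (p d) (nat (g d mod int (p d)))"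
proof -
  show "prime (p d)" "residue_primroot (p d) (nat (g d mod int (p d)))"
    using assms unfolding F_sequence_def by metis+
  have "[p d = 1] (mod d)" using assms unfolding F_sequence_def by metis
  then show "d dvd p d - 1" by (rule cong_to_1_nat)
qed

text \<open>The multiplier \<open>g d ^ ((p d - 1) div d)\<close> has multiplicative order exactly \<open>d\<close>.\<close>

lemma multiplier_power_cong_1_iff:
  assumes F: "F_sequence p g" and d: "d \<ge> 1" and ne: "p d \<noteq> 1"
  shows "[g d ^ ((p d - 1) div d * n) = 1] (mod int (p d)) \<longleftrightarrow> d dvd n"
proof -
  note P = F_sequence_primeD[OF F d ne]
  define a where "a = nat (g d mod int (p d))"
  have pos: "p d > 0" using P(1) prime_gt_0_nat by blast
  have gt: "p d > 1" using P(1) prime_gt_1_nat by blast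
  have a: "int a = g d mod int (p d)" using pos by (simp add: a_def)
  obtain m where m: "p d - 1 = d * m" using P(2) by (auto elim: dvdE)
  have m0: "m > 0" using m gt by (cases m) auto
  have mdiv: "(p d - 1) div d = m" using m d by simp
  have ord: "ord (p d) a = d * m"
    using P(3) P(1) m unfolding a_def[symmetric] residue_primroot_def by (simp add: totient_prime)
  have "[g d ^ (m * n) = 1] (mod int (p d)) \<longleftrightarrow> [int a ^ (m * n) = 1] (mod int (p d))"
    by (simp add: cong_def a power_mod)
  also have "\<dots> \<longleftrightarrow> [a ^ (m * n) = 1] (mod p d)"
    by (metis cong_int_iff of_nat_1 of_nat_power)
  also have "\<dots> \<longleftrightarrow> d * m dvd m * n"
    by (simp only: ord_divides ord)
  also have "\<dots> \<longleftrightarrow> d dvd n"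
    using m0 by (simp add: mult.commute)
  finally show ?thesis by (simp only: mdiv)
qed

lemma carrier_F_group: "carrier (F_group p) = (\<Pi>\<^sub>E d\<in>{1..}. {0..int (p d) - 1})"
  by (simp add: F_group_def residue_ring_def)

text \<open>The map \<open>T\<close> is only known to agree with \<open>F_map p g\<close> on the carrier, so the formula for its
  iterates is proved together with the invariance of the carrier.\<close>

lemma funpow_eq_on_carrier:
  assumes F: "F_sequence p g"
    and T: "\<And>x. x \<in> carrier (F_group p) \<Longrightarrow> T x = F_map p g x"
    and x: "x \<in> carrier (F_group p)"
  shows "(T ^^ n) x \<in> carrier (F_group p) \<and>
         (T ^^ n) x = (\<lambda>d\<in>{1..}. (g d ^ ((p d - 1) div d * n) * x d) mod int (p d))"
proof (induction n)
  case 0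
  have "x = (\<lambda>d\<in>{1..}. x d mod int (p d))"
    using x by (auto simp: carrier_F_group fun_eq_iff PiE_iff extensional_def restrict_def)
  then show ?case using x by simp
next
  case (Suc n)
  let ?y = "(T ^^ n) x"
  have y: "?y \<in> carrier (F_group p)" by (rule conjunct1[OF Suc])
  have "F_map p g ?y \<in> carrier (F_group p)"
    using F_map_bij[OF F] y by (auto simp: bij_betw_def)
  moreover have "F_map p g ?y = (\<lambda>d\<in>{1..}. (g d ^ ((p d - 1) div d * Suc n) * x d) mod int (p d))"
    unfolding F_map_factor[OF F y]
  proof (rule restrict_ext)
    fix d :: nat
    let ?u = "g d ^ ((p d - 1) div d)"
    assume "d \<in> {1..}"
    then have "?y d = ?u ^ n * x d mod int (p d)"
      by (simp add: conjunct2[OF Suc] power_mult)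
    then have "?u * ?y d mod int (p d) = ?u * (?u ^ n * x d) mod int (p d)"
      by (simp only: mod_mult_right_eq)
    then show "?u * ?y d mod int (p d) = g d ^ ((p d - 1) div d * Suc n) * x d mod int (p d)"
      by (simp only: power_mult power_Suc mult.assoc)
  qed
  ultimately show ?case unfolding funpow.simps o_apply T[OF y] by (rule conjI)
qed

text \<open>For \<open>p d = 1\<close> the statement is degenerate: the only element of the factor is \<open>0\<close>.\<close>

lemma factor_fixed_iff:
  assumes F: "F_sequence p g" and d: "d \<ge> 1" and z: "z \<in> {0..int (p d) - 1}"
  shows "(g d ^ ((p d - 1) div d * n) * z) mod int (p d) = z \<longleftrightarrow> d dvd n \<or> z = 0"
proof (cases "p d = 1")
  case False
  let ?P = "int (p d)" and ?v = "g d ^ ((p d - 1) div d * n)"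
  have pr: "prime ?P" using F_sequence_primeD[OF F d False] by simp
  have zm: "z mod ?P = z" using z by simp
  have "(?v * z) mod ?P = z \<longleftrightarrow> [?v * z = z] (mod ?P)"
    by (simp add: cong_def zm)
  also have "\<dots> \<longleftrightarrow> ?P dvd (?v - 1) * z"
    by (simp add: cong_iff_dvd_diff left_diff_distrib)
  also have "\<dots> \<longleftrightarrow> [?v = 1] (mod ?P) \<or> ?P dvd z"
    using pr by (simp add: prime_dvd_mult_iff cong_iff_dvd_diff)
  also have "?P dvd z \<longleftrightarrow> z = 0" using zm by (auto simp: dvd_eq_mod_eq_0)
  finally show ?thesis using multiplier_power_cong_1_iff[OF F d False] by simp
qed (use z in auto)

lemma num_fixed_eq_prod:
  assumes F: "F_sequence p g"
    and T: "\<And>x. x \<in> carrier (F_group p) \<Longrightarrow> T x = F_map p g x"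
    and n: "n \<ge> 1"
  shows "num_fixed (F_group p) T n = (\<Prod>d | d dvd n. p d)"
proof -
  let ?C = "\<lambda>d. {0..int (p d) - 1}"
  let ?D = "{d. d dvd n}"
  let ?ext = "\<lambda>y. \<lambda>d\<in>{1..}. if d dvd n then y d else 0"
  let ?S = "{x \<in> carrier (F_group p). (T ^^ n) x = x}"
  have Dpos: "d \<ge> 1" if "d dvd n" for d using that n by (cases d) auto
  have fin: "finite ?D" using n by simp
  have fixed_iff: "(T ^^ n) x = x \<longleftrightarrow> (\<forall>d\<ge>1. d dvd n \<or> x d = 0)" if x: "x \<in> carrier (F_group p)" for x
  proof -
    have "(T ^^ n) x = x \<longleftrightarrow> (\<forall>d\<ge>1. (g d ^ ((p d - 1) div d * n) * x d) mod int (p d) = x d)"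
      using funpow_eq_on_carrier[OF F T x, of n] x
      by (auto simp: carrier_F_group fun_eq_iff PiE_iff extensional_def restrict_def)
    also have "\<dots> \<longleftrightarrow> (\<forall>d\<ge>1. d dvd n \<or> x d = 0)"
      using factor_fixed_iff[OF F, of _ "x _" n] x by (simp add: carrier_F_group PiE_iff)
    finally show ?thesis .
  qed
  have S: "?S = {x \<in> carrier (F_group p). \<forall>d\<ge>1. d dvd n \<or> x d = 0}"
    using fixed_iff by blast
  have zero: "0 \<in> ?C d" if "d \<ge> 1" for d using F_factor_unit(1)[OF F that] by simp
  \<comment> \<open>A fixed point is determined by its coordinates at the divisors of \<open>n\<close>, which are arbitrary.\<close>
  have "bij_betw (\<lambda>x. restrict x ?D) ?S (\<Pi>\<^sub>E d\<in>?D. ?C d)"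
  proof (rule bij_betw_byWitness[where f' = ?ext])
    show "\<forall>x\<in>?S. ?ext (restrict x ?D) = x"
      unfolding S by (auto simp: carrier_F_group fun_eq_iff PiE_iff extensional_def)
    show "\<forall>y\<in>\<Pi>\<^sub>E d\<in>?D. ?C d. restrict (?ext y) ?D = y"
      using Dpos by (fastforce simp: fun_eq_iff PiE_iff extensional_def)
    show "(\<lambda>x. restrict x ?D) ` ?S \<subseteq> (\<Pi>\<^sub>E d\<in>?D. ?C d)"
      unfolding S using Dpos by (auto simp: carrier_F_group PiE_iff split: if_splits)
    show "?ext ` (\<Pi>\<^sub>E d\<in>?D. ?C d) \<subseteq> ?S"
      unfolding S using zero by (auto simp: carrier_F_group PiE_iff)
  qed
  then have "card ?S = card (\<Pi>\<^sub>E d\<in>?D. ?C d)" by (rule bij_betw_same_card)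
  also have "\<dots> = (\<Prod>d\<in>?D. p d)" using fin by (simp add: card_PiE)
  finally show ?thesis by (simp add: num_fixed_def)
qed

lemma divisors_prime_power_Suc:
  fixes q :: nat
  assumes "prime q"
  shows "{d. d dvd q ^ Suc k} = insert (q ^ Suc k) {d. d dvd q ^ k}"
proof -
  have "d dvd q ^ m \<longleftrightarrow> (\<exists>i\<le>m. d = q ^ i)" for d m
    using assms by (rule divides_primepow_nat)
  then show ?thesis by (auto simp del: power_Suc simp: le_Suc_eq)
qed

lemma num_fixed_prime_power_Suc:
  assumes F: "F_sequence p g"
    and T: "\<And>x. x \<in> carrier (F_group p) \<Longrightarrow> T x = F_map p g x"
    and q: "prime q"
  shows "num_fixed (F_group p) T (q ^ Suc k) = p (q ^ Suc k) * num_fixed (F_group p) T (q ^ k)"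
proof -
  have q1: "q > 1" using q prime_gt_1_nat by blast
  have "\<not> q ^ Suc k dvd q ^ k"
    using q1 by (simp only: power_dvd_imp_le Suc_n_not_le_n dvd_power_iff_le) auto
  moreover have "q ^ m \<ge> 1" for m using q1 by simp
  moreover have "finite {d. d dvd q ^ k}" using q1 by simp
  ultimately show ?thesis
    using num_fixed_eq_prod[OF F T] by (simp add: divisors_prime_power_Suc[OF q] del: power_Suc)
qed

theorem mainTheorem8:
  fixes k :: nat
  assumes "k \<ge> 1"
  shows "\<not> (\<exists>G \<tau> T. constructed_with_F_method G \<tau> T \<and>
           (\<lambda>n. ln (real (num_fixed G T n)) / (real k * ln (real n))) \<longlonglongrightarrow> 1)"
proof (intro notI, elim exE conjE)
  fix G \<tau> T
  assume "constructed_with_F_method G \<tau> T"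
  then obtain p g where F: "F_sequence p g" and G: "G = F_group p"
    and "\<forall>x\<in>carrier G. T x = F_map p g x"
    unfolding constructed_with_F_method_def by blast
  then have T: "\<And>x. x \<in> carrier (F_group p) \<Longrightarrow> T x = F_map p g x" by simp
  define L where "L n = ln (real (num_fixed G T n))" for n
  assume "(\<lambda>n. ln (real (num_fixed G T n)) / (real k * ln (real n))) \<longlonglongrightarrow> 1"
  then have lim: "(\<lambda>n. L n / (real k * ln (real n))) \<longlonglongrightarrow> 1" by (simp add: L_def)
  \<comment> \<open>With this \<open>\<epsilon>\<close> the errors at \<open>q ^ k\<close> and \<open>q ^ (k + 1)\<close> are bounded by a total of \<open>ln q\<close>.\<close>
  define \<epsilon> :: real where "\<epsilon> = 1 / (k * (2 * k + 1))"
  have c: "real (k * (2 * k + 1)) > 0" using assms by (simp only: of_nat_0_less_iff) simp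
  then have "\<epsilon> > 0" unfolding \<epsilon>_def by (rule divide_pos_pos[OF zero_less_one])
  then obtain N where N: "\<And>n. n \<ge> N \<Longrightarrow> \<bar>L n / (real k * ln (real n)) - 1\<bar> < \<epsilon>"
    using LIMSEQ_D[OF lim] by (metis real_norm_def)
  obtain q where q: "prime q" "q > N" using bigger_prime by blast
  define l where "l = ln (real q)"
  have q1: "q > 1" using q(1) prime_gt_1_nat by blast
  then have l: "l > 0" by (simp add: l_def)
  have bound: "\<bar>L (q ^ m) - k * m * l\<bar> < \<epsilon> * (k * m * l)" if m: "m \<ge> 1" for m
  proof -
    have pos: "k * m * l > 0" using assms m l by simp
    have "q \<le> q ^ m" using m q1 by (simp add: self_le_power)
    then have "\<bar>L (q ^ m) / (k * m * l) - 1\<bar> < \<epsilon>"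
      using N[of "q ^ m"] q(2) q1 by (simp add: l_def ln_realpow mult.assoc)
    moreover have "\<bar>L (q ^ m) - k * m * l\<bar> = \<bar>L (q ^ m) / (k * m * l) - 1\<bar> * (k * m * l)"
    proof -
      have "L (q ^ m) - k * m * l = (L (q ^ m) / (k * m * l) - 1) * (k * m * l)"
        using assms m l by (simp add: left_diff_distrib)
      then show ?thesis using l by (simp add: abs_mult)
    qed
    ultimately show ?thesis using mult_strict_right_mono[OF _ pos] by metis
  qed
  define D where "D = L (q ^ Suc k) - L (q ^ k)"
  have "\<epsilon> * (k * k * l) + \<epsilon> * (k * Suc k * l) = l"
  proof -
    have "\<epsilon> * (k * k * l) + \<epsilon> * (k * Suc k * l) = \<epsilon> * (k * (2 * k + 1)) * l"
      by (simp add: algebra_simps)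
    also have "\<epsilon> * (k * (2 * k + 1)) = 1" using c by (simp only: \<epsilon>_def) simp
    finally show ?thesis by simp
  qed
  moreover have "k * Suc k * l - k * k * l = k * l" by (simp add: algebra_simps)
  ultimately have D: "\<bar>D - k * l\<bar> < l"
    using bound[of k] bound[of "Suc k"] assms unfolding D_def by linarith
  have "k * l \<ge> l" using assms l by simp
  with D have D_pos: "D > 0" by linarith
  have D_less: "D < Suc k * l" using D by (simp add: algebra_simps)

  let ?r = "p (q ^ Suc k)"
  have qk: "q ^ m \<ge> 1" for m using q1 by simp
  have r0: "?r > 0" using F_factor_unit(1)[OF F qk] .
  have "num_fixed G T (q ^ k) > 0"
    using num_fixed_eq_prod[OF F T qk] F_factor_unit(1)[OF F] q1 unfolding G
    by (auto intro!: prod_pos simp: Suc_le_eq dest!: dvd_pos_nat[rotated])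
  then have "D = ln ?r"
    using num_fixed_prime_power_Suc[OF F T q(1), of k] r0
    by (simp add: D_def L_def G ln_mult del: power_Suc)
  with D_pos have r1: "?r \<noteq> 1" by auto
  have "q ^ Suc k dvd ?r - 1" using F_sequence_primeD(2)[OF F qk r1] .
  then have "q ^ Suc k \<le> ?r" using r0 r1 by (auto dest!: dvd_imp_le simp del: power_Suc)
  then have "ln (real (q ^ Suc k)) \<le> ln ?r"
    using q1 r0 by (subst ln_le_cancel_iff) (auto simp del: power_Suc simp: of_nat_le_iff)
  then have "Suc k * l \<le> D"
    using q1 \<open>D = ln ?r\<close> by (simp add: l_def ln_realpow del: power_Suc)
  with D_less show False by simp
qed

end
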